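(* Let $n\ge 2$, $|q|<1$. The matrix $$R^D(z)=p(z)\Bigl(\sum_{i=1}^n\frac1{1-z}E_{ii}\otimes E_{ii}+\frac{q-q^{-1}z}{(1-z)^2}\sum_{i<j}E_{ii}\otimes E_{jj}+\frac1{q^{-1}-qz}\sum_{i>j}E_{ii}\otimes E_{jj}+\delta(z)\sum_{i>j}E_{ij}\otimes E_{ji}\Bigr)$$ (the image of the universal $R$-matrix of $U_q^D(\widehat{\mathfrak{sl}}_n)$ in the tensor product of two vector representations) does not satisfy the Yang–Baxter equation $$R^D_{12}(z)R^D_{13}(zw)R^D_{23}(w)=R^D_{23}(w)R^D_{13}(zw)R^D_{12}(z).$$
   Context: Here $E_{ij}$ are the standard matrix units of $\mathrm{End}(\mathbb C^n)$, $\delta(z)=\sum_{k\in\mathbb Z}z^k$, $(x;p)=\prod_{k\ge0}(1-p^kx)$, $$p(z)=q^{-\frac{n-1}{n}}\frac{(zq^2;q^{2n})(zq^{2n-2};q^{2n})}{(zq^{2n};q^{2n})^2}.$$ All functions of $z$ are expanded as formal series in nonnegative powers of $z$ (so $1/(1-z)=\sum_{k\ge0}z^k$), while $\delta(z)$ is a two-sided formal series. $R^D_{ab}$ denotes $R^D$ acting in the $a$-th and $b$-th factors of $(\mathbb C^n)^{\otimes3}$. Products of formal series in $z,w$ are defined when every coefficient is given by a convergent sum. "Satisfies the Yang–Baxter equation" means that both sides are well defined in this sense and equal. *)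

theory Defs
  imports "HOL-Complex_Analysis.Complex_Analysis"
begin

text \<open>
  The space \<open>\<complex>\<^sup>n\<close> is \<open>complex ^ 'n\<close> for a finite linearly ordered index type \<open>'n\<close> with
  \<open>CARD('n) = n\<close>.  Its tensor square and cube have the index types \<open>'n \<times> 'n\<close> and
  \<open>'n \<times> 'n \<times> 'n\<close>; a matrix \<open>A\<close> has the entry \<open>A $ row $ column\<close>.
\<close>

type_synonym 'n op1 = "complex ^ 'n ^ 'n"
type_synonym 'n op2 = "complex ^ ('n \<times> 'n) ^ ('n \<times> 'n)"
type_synonym 'n op3 = "complex ^ ('n \<times> 'n \<times> 'n) ^ ('n \<times> 'n \<times> 'n)"

definition cscale :: "complex \<Rightarrow> complex ^ 'm ^ 'm \<Rightarrow> complex ^ 'm ^ 'm" where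
  "cscale c A = (\<chi> i j. c * A $ i $ j)"

definition matrix_unit :: "'n \<Rightarrow> 'n \<Rightarrow> 'n::finite op1" where
  "matrix_unit i j = (\<chi> a b. if a = i \<and> b = j then 1 else 0)"

definition tensor :: "'n op1 \<Rightarrow> 'n op1 \<Rightarrow> 'n::finite op2" where
  "tensor A B = (\<chi> r c. A $ fst r $ fst c * B $ snd r $ snd c)"

definition act12 :: "'n op2 \<Rightarrow> 'n::finite op3" where
  "act12 A = (\<chi> r c. case (r, c) of ((a, b, d), (a', b', d')) \<Rightarrow>
     if d = d' then A $ (a, b) $ (a', b') else 0)"

definition act13 :: "'n op2 \<Rightarrow> 'n::finite op3" where
  "act13 A = (\<chi> r c. case (r, c) of ((a, b, d), (a', b', d')) \<Rightarrow>
     if b = b' then A $ (a, d) $ (a', d') else 0)"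

definition act23 :: "'n op2 \<Rightarrow> 'n::finite op3" where
  "act23 A = (\<chi> r c. case (r, c) of ((a, b, d), (a', b', d')) \<Rightarrow>
     if a = a' then A $ (b, d) $ (b', d') else 0)"

text \<open>
  A two-sided formal series in \<open>z\<close> is the function sending an exponent \<open>k :: int\<close> to its
  coefficient; a series in \<open>z, w\<close> is indexed by pairs of exponents.  Infinite sums are
  unconditional (\<open>summable_on\<close>, \<open>infsum\<close>), since the index sets carry no preferred order.
\<close>

definition expand :: "(complex \<Rightarrow> complex) \<Rightarrow> int \<Rightarrow> complex" where
  "expand f k = (if k < 0 then 0 else fps_nth (fps_expansion f 0) (nat k))"

definition delta :: "int \<Rightarrow> complex" where
  "delta k = 1"

definition qpoch :: "complex \<Rightarrow> complex \<Rightarrow> complex" where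
  "qpoch x p = (\<Prod>k. 1 - p ^ k * x)"

text \<open>The argument \<open>s\<close> is a chosen \<open>n\<close>-th root of \<open>q\<close>, so that \<open>q\<^bsup>-(n-1)/n\<^esup> = s\<^bsup>-(n-1)\<^esup>\<close>.\<close>

definition prefactor :: "nat \<Rightarrow> complex \<Rightarrow> complex \<Rightarrow> complex \<Rightarrow> complex" where
  "prefactor n q s z =
     inverse (s ^ (n - 1)) *
     (qpoch (z * q ^ 2) (q ^ (2 * n)) * qpoch (z * q ^ (2 * n - 2)) (q ^ (2 * n)) /
      (qpoch (z * q ^ (2 * n)) (q ^ (2 * n))) ^ 2)"

definition RD_bracket :: "complex \<Rightarrow> int \<Rightarrow> 'n::{finite,linorder} op2" where
  "RD_bracket q k =
     cscale (expand (\<lambda>z. 1 / (1 - z)) k)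
       (\<Sum>i\<in>UNIV. tensor (matrix_unit i i) (matrix_unit i i)) +
     cscale (expand (\<lambda>z. (q - inverse q * z) / (1 - z) ^ 2) k)
       (\<Sum>(i, j) | i < j. tensor (matrix_unit i i) (matrix_unit j j)) +
     cscale (expand (\<lambda>z. 1 / (inverse q - q * z)) k)
       (\<Sum>(i, j) | i > j. tensor (matrix_unit i i) (matrix_unit j j)) +
     cscale (delta k)
       (\<Sum>(i, j) | i > j. tensor (matrix_unit i j) (matrix_unit j i))"

text \<open>
  The product of the one-sided series of the prefactor with the two-sided bracket.  For
  \<open>0 < \<bar>q\<bar> < 1\<close> the sum converges, as the prefactor is holomorphic for \<open>\<bar>z\<bar> < \<bar>q\<bar>\<^bsup>-2n\<^esup>\<close>.
\<close>

definition RD :: "complex \<Rightarrow> complex \<Rightarrow> int \<Rightarrow> 'n::{finite,linorder} op2" where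
  "RD q s k = (\<Sum>\<^sub>\<infinity>l. cscale (expand (prefactor CARD('n) q s) (k - l)) (RD_bracket q l))"

definition in_z :: "(int \<Rightarrow> 'a) \<Rightarrow> int \<times> int \<Rightarrow> 'a::zero" where
  "in_z A = (\<lambda>(a, b). if b = 0 then A a else 0)"

definition in_w :: "(int \<Rightarrow> 'a) \<Rightarrow> int \<times> int \<Rightarrow> 'a::zero" where
  "in_w A = (\<lambda>(a, b). if a = 0 then A b else 0)"

definition in_zw :: "(int \<Rightarrow> 'a) \<Rightarrow> int \<times> int \<Rightarrow> 'a::zero" where
  "in_zw A = (\<lambda>(a, b). if a = b then A a else 0)"

definition triple_terms ::
  "(int \<times> int \<Rightarrow> complex ^ 'm ^ 'm) \<Rightarrow> (int \<times> int \<Rightarrow> complex ^ 'm ^ 'm) \<Rightarrow>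
   (int \<times> int \<Rightarrow> complex ^ 'm ^ 'm) \<Rightarrow> int \<times> int \<Rightarrow>
   (int \<times> int) \<times> (int \<times> int) \<Rightarrow> complex ^ 'm ^ 'm" where
  "triple_terms F G H m = (\<lambda>(s, t). F s ** G t ** H (m - s - t))"

definition triple_product_defined ::
  "(int \<times> int \<Rightarrow> complex ^ 'm ^ 'm) \<Rightarrow> (int \<times> int \<Rightarrow> complex ^ 'm ^ 'm) \<Rightarrow>
   (int \<times> int \<Rightarrow> complex ^ 'm ^ 'm) \<Rightarrow> bool" where
  "triple_product_defined F G H \<longleftrightarrow> (\<forall>m. triple_terms F G H m summable_on UNIV)"

definition triple_product ::
  "(int \<times> int \<Rightarrow> complex ^ 'm ^ 'm) \<Rightarrow> (int \<times> int \<Rightarrow> complex ^ 'm ^ 'm) \<Rightarrow>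
   (int \<times> int \<Rightarrow> complex ^ 'm ^ 'm) \<Rightarrow> int \<times> int \<Rightarrow> complex ^ 'm ^ 'm" where
  "triple_product F G H m = infsum (triple_terms F G H m) UNIV"

definition satisfies_YBE :: "(int \<Rightarrow> 'n::finite op2) \<Rightarrow> bool" where
  "satisfies_YBE R \<longleftrightarrow>
     (let R12 = in_z (\<lambda>k. act12 (R k));
          R13 = in_zw (\<lambda>k. act13 (R k));
          R23 = in_w (\<lambda>k. act23 (R k))
      in triple_product_defined R12 R13 R23 \<and>
         triple_product_defined R23 R13 R12 \<and>
         triple_product R12 R13 R23 = triple_product R23 R13 R12)"

end

theory Submission
  imports Defs
begin

unbundle no fps_syntax

text \<open>
  The right-hand side of the equation is not even well defined.  For \<open>u < v\<close>, the only path from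
  \<open>e\<^sub>u \<otimes> e\<^sub>u \<otimes> e\<^sub>v\<close> to \<open>e\<^sub>v \<otimes> e\<^sub>u \<otimes> e\<^sub>u\<close> through \<open>R\<^sub>2\<^sub>3 R\<^sub>1\<^sub>3 R\<^sub>1\<^sub>2\<close> contributes \<open>a(w) P \<delta>(zw) a(z)\<close>,
  where \<open>a(z) = p(z) / (1 - z)\<close> and \<open>P = p(1)\<close>.  The coefficient of \<open>z\<^sup>0 w\<^sup>0\<close> in this
  product is the series \<open>\<Sum>m. a\<^sub>m P a\<^sub>m\<close>.  As \<open>p\<close> is holomorphic on a disc of radius greater
  than \<open>1\<close>, the coefficients \<open>a\<^sub>m\<close>, which are the partial sums of the coefficients of \<open>p\<close>,
  tend to \<open>P\<close>, so the terms of the series tend to \<open>P\<^sup>3 \<noteq> 0\<close> and the series diverges.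
\<close>

section \<open>The prefactor\<close>

lemma summable_norm_geometric_mult:
  fixes p x :: complex
  assumes "norm p < 1"
  shows "summable (\<lambda>k. norm (p ^ k * x))"
  using assms by (auto simp: norm_mult norm_power intro!: summable_mult2 summable_geometric)

lemma convergent_prod_qpoch:
  fixes p x :: complex
  assumes "norm p < 1"
  shows "convergent_prod (\<lambda>k. 1 - p ^ k * x)"
  by (intro abs_convergent_prod_imp_convergent_prod summable_imp_abs_convergent_prod)
     (use summable_norm_geometric_mult[OF assms] in \<open>simp add: norm_minus_commute\<close>)

text \<open>A product convergent in the sense of \<open>convergent_prod\<close> vanishes only if
  some factor does, and here |p^i x| \<le> |x| < 1 for every i.\<close>

lemma qpoch_nonzero:
  assumes "norm p < 1" "norm x < 1"
  shows "qpoch x p \<noteq> 0"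
  unfolding qpoch_def
proof (rule prodinf_nonzero[OF convergent_prod_qpoch[OF assms(1)]])
  fix i
  have "norm p ^ i * norm x \<le> 1 * norm x"
    using assms by (intro mult_right_mono power_le_one) auto
  hence "norm (p ^ i * x) < 1"
    using assms by (simp add: norm_mult norm_power)
  thus "1 - p ^ i * x \<noteq> 0" by auto
qed

text \<open>The finite products are polynomials in x and converge uniformly on each closed unit
  disc, by the M-test with majorant |p|^k B.\<close>

lemma qpoch_holomorphic:
  assumes "norm p < 1"
  shows "(\<lambda>x. qpoch x p) holomorphic_on UNIV"
proof (rule holomorphic_uniform_sequence[OF open_UNIV])
  show "(\<lambda>x. \<Prod>k<N. 1 - p ^ k * x) holomorphic_on UNIV" for N
    by (intro holomorphic_intros)
next
  fix x :: complex
  define B where "B = norm x + 1"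
  have bound: "norm y \<le> B" if "y \<in> cball x 1" for y
    using that norm_triangle_ineq2[of y x] by (simp add: B_def dist_norm norm_minus_commute)
  have "uniformly_convergent_on (cball x 1) (\<lambda>N y. \<Sum>k<N. norm ((1 - p ^ k * y) - 1))"
  proof (rule Weierstrass_m_test')
    show "norm (norm ((1 - p ^ k * y) - 1)) \<le> norm p ^ k * B" if "y \<in> cball x 1" for k y
      using bound[OF that] by (auto simp: norm_mult norm_power intro!: mult_left_mono)
    show "summable (\<lambda>k. norm p ^ k * B)"
      using assms by (intro summable_mult2 summable_geometric) auto
  qed
  hence "uniformly_convergent_on (cball x 1) (\<lambda>N y. \<Prod>k<N. 1 - p ^ k * y)"
    by (intro uniformly_convergent_on_prod' continuous_intros compact_cball)
  then obtain g where g: "uniform_limit (cball x 1) (\<lambda>N y. \<Prod>k<N. 1 - p ^ k * y) g sequentially"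
    by (auto simp: uniformly_convergent_on_def)
  \<comment> \<open>Uniform convergence only supplies some limit g; its pointwise values identify it
    with the infinite product.\<close>
  have "g y = qpoch y p" if "y \<in> cball x 1" for y
  proof (rule LIMSEQ_unique[OF tendsto_uniform_limitI[OF g that]])
    show "(\<lambda>N. \<Prod>k<N. 1 - p ^ k * y) \<longlonglongrightarrow> qpoch y p"
      unfolding qpoch_def LIMSEQ_lessThan_iff_atMost
      by (rule convergent_prod_LIMSEQ[OF convergent_prod_qpoch[OF assms]])
  qed
  hence "uniform_limit (cball x 1) (\<lambda>N y. \<Prod>k<N. 1 - p ^ k * y) (\<lambda>y. qpoch y p) sequentially"
    by (intro uniform_limit_cong'[THEN iffD1, OF _ _ g]) auto
  thus "\<exists>d>0. cball x d \<subseteq> UNIV \<and>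
      uniform_limit (cball x d) (\<lambda>N y. \<Prod>k<N. 1 - p ^ k * y) (\<lambda>y. qpoch y p) sequentially"
    by (intro exI[of _ 1]) auto
qed

text \<open>Only the denominator matters: its argument satisfies |z q^(2n)| \<le> |z| |q| < 1 on
  this disc. The radius 1/|q| exceeds 1, so z = 1 is an interior point.\<close>

lemma prefactor_holomorphic:
  assumes "n > 0" "q \<noteq> 0" "norm q < 1"
  shows "prefactor n q s holomorphic_on ball 0 (inverse (norm q))"
proof -
  have p: "norm (q ^ (2 * n)) < 1"
    using assms power_less_one_iff[of "norm q" "2 * n"] by (simp add: norm_power)
  have hol: "(\<lambda>z. qpoch (z * c) (q ^ (2 * n))) holomorphic_on A" for c A
    using holomorphic_on_compose_gen[OF _ qpoch_holomorphic[OF p], of "\<lambda>z. z * c" A]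
    by (simp add: o_def holomorphic_intros)
  have "qpoch (z * q ^ (2 * n)) (q ^ (2 * n)) \<noteq> 0" if "z \<in> ball 0 (inverse (norm q))" for z
  proof (rule qpoch_nonzero[OF p])
    have "norm q ^ (2 * n) \<le> norm q ^ 1"
      using assms by (intro power_decreasing) auto
    hence "norm (z * q ^ (2 * n)) \<le> norm z * norm q"
      by (auto simp: norm_mult norm_power intro!: mult_left_mono)
    also have "\<dots> < 1"
      using that assms by (simp add: field_simps)
    finally show "norm (z * q ^ (2 * n)) < 1" .
  qed
  thus ?thesis
    unfolding prefactor_def[abs_def] by (intro holomorphic_intros hol) auto
qed

text \<open>At z = 1 the three arguments are q^2, q^(2n-2) and q^(2n); as n \<ge> 2, all exponents
  are positive, so the arguments lie in the open unit disc.\<close>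

lemma prefactor_1_nonzero:
  assumes "n \<ge> 2" "norm q < 1" "s \<noteq> 0"
  shows "prefactor n q s 1 \<noteq> 0"
proof -
  have less: "norm (q ^ k) < 1" if "k > 0" for k
    using assms that power_less_one_iff[of "norm q" k] by (simp add: norm_power)
  have "qpoch (1 * q ^ k) (q ^ (2 * n)) \<noteq> 0" if "k > 0" for k
    using that assms by (intro qpoch_nonzero) (auto intro!: less)
  thus ?thesis
    using assms unfolding prefactor_def by simp
qed

section \<open>Expansions\<close>

lemma expand_negative: "k < 0 \<Longrightarrow> expand f k = 0"
  by (simp add: expand_def)

lemma expand_holomorphic_sums:
  assumes "f holomorphic_on ball 0 r" "r > 1"
  shows "(\<lambda>n. expand f (int n)) sums f 1" "summable (\<lambda>n. norm (expand f (int n)))"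
proof -
  have coeff: "expand f (int n) = (deriv ^^ n) f 0 / fact n" for n
    by (simp add: expand_def fps_expansion_def)
  show "(\<lambda>n. expand f (int n)) sums f 1"
    using holomorphic_power_series[OF assms(1), of 1] assms(2) by (simp add: coeff)
  \<comment> \<open>Convergence of the power series at a point t > 1 forces absolute convergence at
    1.\<close>
  obtain t where t: "1 < t" "t < r" using assms(2) dense by blast
  have "summable (\<lambda>n. expand f (int n) * of_real t ^ n)"
    using holomorphic_power_series[OF assms(1), of "of_real t"] t
    by (auto simp: coeff sums_iff)
  from powser_insidea[OF this, of 1] t
  show "summable (\<lambda>n. norm (expand f (int n)))" by simp
qed

lemma has_sum_int_of_nat:
  fixes f :: "int \<Rightarrow> 'a :: banach"
  assumes "\<And>k. k < 0 \<Longrightarrow> f k = 0" "summable (\<lambda>n. norm (f (int n)))" "(\<lambda>n. f (int n)) sums S"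
  shows "(f has_sum S) UNIV"
proof -
  have "((f \<circ> int) has_sum S) UNIV"
    using norm_summable_imp_has_sum[OF assms(2,3)] by (simp add: o_def)
  hence "(f has_sum S) (range int)"
    by (subst has_sum_reindex) auto
  moreover have "k \<in> range int" if "f k \<noteq> 0" for k
    using assms(1)[of k] that by (metis linorder_not_less nonneg_int_cases rangeI)
  ultimately show ?thesis
    using has_sum_cong_neutral[of UNIV "range int" f f S] by auto
qed

lemma expand_geometric: "expand (\<lambda>z. 1 / (1 - z)) k = (if k < 0 then 0 else 1)"
proof -
  have "(\<lambda>z::complex. inverse (1 - z)) has_fps_expansion inverse (1 - fps_X)"
    by (intro fps_expansion_intros) auto
  hence "fps_expansion (\<lambda>z::complex. 1 / (1 - z)) 0 = inverse (1 - fps_X)"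
    by (intro fps_expansion_eqI) (simp add: inverse_eq_divide)
  also have "\<dots> = inverse (inverse (Abs_fps (\<lambda>_. 1)))"
    by (subst fps_inverse_gp') simp
  also have "\<dots> = Abs_fps (\<lambda>_. 1)"
    by (rule fps_inverse_idempotent) simp
  finally show ?thesis by (simp add: expand_def)
qed

section \<open>The entries of the R-matrix\<close>

lemma cscale_nth [simp]: "cscale c A $ i $ j = c * A $ i $ j"
  by (simp add: cscale_def)

lemma bounded_linear_cscale: "bounded_linear (\<lambda>c. cscale c A)"
  unfolding linear_conv_bounded_linear[symmetric]
  by (rule linearI) (simp_all add: vec_eq_iff algebra_simps)

lemma bounded_linear_entry: "bounded_linear (\<lambda>A :: complex ^ 'm ^ 'k. A $ i $ j)"
  by (intro bounded_linear_compose[OF bounded_linear_vec_nth bounded_linear_vec_nth])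

text \<open>The three diagonal families have disjoint supports, so they merge into one case
  distinction on the order of a and b. The \<delta> term sits at transposed indices and does not
  depend on k.\<close>

lemma RD_bracket_nth:
  "RD_bracket q k $ (a, b) $ (a', b') =
     (if a = a' \<and> b = b' then
        expand (if a = b then (\<lambda>z. 1 / (1 - z))
                else if a < b then (\<lambda>z. (q - inverse q * z) / (1 - z) ^ 2)
                else (\<lambda>z. 1 / (inverse q - q * z))) k
      else 0) + (if a = b' \<and> b = a' \<and> a > b then 1 else 0)"
proof -
  have diag: "(\<Sum>i\<in>UNIV. tensor (matrix_unit i i) (matrix_unit i i)) $ (a, b) $ (a', b') =
      (if a = a' \<and> b = b' \<and> a = b then 1 else 0)"
  proof -
    have "(\<Sum>i\<in>UNIV. tensor (matrix_unit i i) (matrix_unit i i)) $ (a, b) $ (a', b') =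
        (\<Sum>i\<in>UNIV. if i = a then (if a = a' \<and> b = b' \<and> a = b then 1 else 0) else 0)"
      unfolding sum_component by (intro sum.cong) (auto simp: tensor_def matrix_unit_def)
    thus ?thesis by simp
  qed
  have pairs: "(\<Sum>(i, j) | P i j. tensor (matrix_unit i i) (matrix_unit j j)) $ (a, b) $ (a', b') =
      (if a = a' \<and> b = b' \<and> P a b then 1 else 0)" for P
  proof -
    have "(\<Sum>(i, j) | P i j. tensor (matrix_unit i i) (matrix_unit j j)) $ (a, b) $ (a', b') =
        (\<Sum>x | case_prod P x. if x = (a, b) then (if a = a' \<and> b = b' then 1 else 0) else 0)"
      unfolding sum_component
      by (intro sum.cong) (auto simp: tensor_def matrix_unit_def split: prod.splits)
    thus ?thesis by simp
  qed
  have perm: "(\<Sum>(i, j) | P i j. tensor (matrix_unit i j) (matrix_unit j i)) $ (a, b) $ (a', b') =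
      (if a = b' \<and> b = a' \<and> P a b then 1 else 0)" for P
  proof -
    have "(\<Sum>(i, j) | P i j. tensor (matrix_unit i j) (matrix_unit j i)) $ (a, b) $ (a', b') =
        (\<Sum>x | case_prod P x. if x = (a, b) then (if a = b' \<and> b = a' then 1 else 0) else 0)"
      unfolding sum_component
      by (intro sum.cong) (auto simp: tensor_def matrix_unit_def split: prod.splits)
    thus ?thesis by simp
  qed
  have merge: "expand f k * (if a = a' \<and> b = b' \<and> a = b then 1 else 0) +
      expand g k * (if a = a' \<and> b = b' \<and> a < b then 1 else 0) +
      expand h k * (if a = a' \<and> b = b' \<and> a > b then 1 else 0) +
      1 * (if a = b' \<and> b = a' \<and> a > b then 1 else 0) =
      (if a = a' \<and> b = b' then expand (if a = b then f else if a < b then g else h) k else 0) +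
      (if a = b' \<and> b = a' \<and> a > b then 1 else 0)" for f g h
  proof (cases a b rule: linorder_cases)
    case less
    with less_imp_neq[OF less] less_not_sym[OF less] show ?thesis
      by (cases "a = a' \<and> b = b'")
         (simp_all only: if_True if_False simp_thms mult_zero_right mult_1_left mult_1_right
           add_0_left add_0_right)
  next
    case equal
    then show ?thesis by auto
  next
    case greater
    with not_sym[OF less_imp_neq[OF greater]] less_not_sym[OF greater] show ?thesis
      by (cases "a = a' \<and> b = b'")
         (simp_all only: if_True if_False simp_thms mult_zero_right mult_1_left mult_1_right
           add_0_left add_0_right)
  qed
  show ?thesis
    by (simp only: RD_bracket_def vector_add_component cscale_nth diag pairs perm delta_def merge)
qed

lemma infsum_nth:
  fixes f :: "'b \<Rightarrow> complex ^ 'm ^ 'k"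
  assumes "f summable_on A"
  shows "infsum f A $ i $ j = (\<Sum>\<^sub>\<infinity>x\<in>A. f x $ i $ j)"
  using has_sum_bounded_linear[OF bounded_linear_entry has_sum_infsum[OF assms]]
  by (rule infsumI[symmetric])

text \<open>The second part encodes p(z) \<delta>(z) = p(1) \<delta>(z): at every exponent k the
  convolution runs over all Taylor coefficients of p, and absolute convergence makes that sum
  unconditional.\<close>

lemma expand_prefactor_sums:
  fixes q s :: complex
  assumes "n > 0" "q \<noteq> 0" "norm q < 1"
  shows "(\<lambda>i. expand (prefactor n q s) (int i)) sums prefactor n q s 1"
    and "((\<lambda>l. expand (prefactor n q s) (k - l)) has_sum prefactor n q s 1) UNIV"
proof -
  let ?p = "expand (prefactor n q s)"
  have "inverse (norm q) > 1" using assms by (simp add: one_less_inverse)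
  note p = expand_holomorphic_sums[OF prefactor_holomorphic[OF assms] this]
  show "(\<lambda>i. ?p (int i)) sums prefactor n q s 1" by (rule p(1))
  have "(?p has_sum prefactor n q s 1) UNIV"
    by (intro has_sum_int_of_nat expand_negative p)
  moreover have "bij (\<lambda>l. k - l)"
    by (rule bij_betw_byWitness[where f' = "\<lambda>l. k - l"]) auto
  ultimately show "((\<lambda>l. ?p (k - l)) has_sum prefactor n q s 1) UNIV"
    by (subst has_sum_reindex_bij_betw[where f = ?p])
qed

text \<open>Since \<open>infsum\<close> is 0 for families that are not summable, entries may be
  taken inside the sum only once the matrix-valued family is known to be summable.\<close>

lemma RD_nth:
  fixes q s :: complex
  assumes "q \<noteq> 0" "norm q < 1"
  shows "(RD q s k :: 'n::{finite,linorder} op2) $ x $ y =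
    (\<Sum>\<^sub>\<infinity>l. expand (prefactor CARD('n) q s) (k - l) * (RD_bracket q l :: 'n op2) $ x $ y)"
proof -
  let ?p = "expand (prefactor CARD('n) q s)"
  \<comment> \<open>Two one-sided series: only the exponents 0 \<le> l \<le> k contribute.\<close>
  have fin: "(\<lambda>l. ?p (k - l) * expand f l) summable_on UNIV" for f
  proof (rule summable_on_cong_neutral[THEN iffD1])
    show "(\<lambda>l. ?p (k - l) * expand f l) summable_on {0..k}"
      by (rule summable_on_finite) auto
    show "?p (k - l) * expand f l = 0" if "l \<in> UNIV - {0..k}" for l
      using that by (auto simp: expand_negative not_le)
  qed auto
  have delta: "(\<lambda>l. ?p (k - l) * delta l) summable_on UNIV"
    using expand_prefactor_sums(2)[OF _ assms, of "CARD('n)"] by (auto simp: delta_def summable_on_def)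
  have scale: "(\<lambda>l. cscale (c l) X) summable_on UNIV" if "c summable_on UNIV"
    for c :: "int \<Rightarrow> complex" and X :: "'n op2"
    by (rule summable_on_bounded_linear[OF bounded_linear_cscale that])
  have split: "cscale c (cscale d1 A + cscale d2 B + cscale d3 C + cscale d4 D) =
      cscale (c * d1) A + cscale (c * d2) B + cscale (c * d3) C + cscale (c * d4) D"
    for c d1 d2 d3 d4 and A B C D :: "'n op2"
    by (simp add: vec_eq_iff algebra_simps)
  have "(\<lambda>l. cscale (?p (k - l)) (RD_bracket q l :: 'n op2)) summable_on UNIV"
    unfolding RD_bracket_def split
    by (intro summable_on_add scale fin delta)
  thus ?thesis
    unfolding RD_def by (simp add: infsum_nth)
qed

text \<open>Multiplying a power series by 1/(1-z) replaces its coefficients by their partial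
  sums.\<close>

lemma RD_diagonal_nth:
  fixes q s :: complex
  assumes "q \<noteq> 0" "norm q < 1"
  shows "(RD q s (int m) :: 'n::{finite,linorder} op2) $ (u, u) $ (u, u) =
    (\<Sum>i\<le>m. expand (prefactor CARD('n) q s) (int i))"
proof -
  let ?p = "expand (prefactor CARD('n) q s)"
  have "(RD q s (int m) :: 'n op2) $ (u, u) $ (u, u) =
      (\<Sum>\<^sub>\<infinity>l. ?p (int m - l) * (if l < 0 then 0 else 1))"
    unfolding RD_nth[OF assms] RD_bracket_nth by (simp add: expand_geometric)
  also have "\<dots> = (\<Sum>\<^sub>\<infinity>l\<in>{0..int m}. ?p (int m - l))"
    by (rule infsum_cong_neutral) (auto simp: expand_negative)
  also have "\<dots> = (\<Sum>l\<in>{0..int m}. ?p (int m - l))"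
    by simp
  also have "\<dots> = (\<Sum>i\<le>m. ?p (int i))"
    by (rule sum.reindex_bij_witness[of _ "\<lambda>i. int m - int i" "\<lambda>l. nat (int m - l)"]) auto
  finally show ?thesis .
qed

section \<open>Failure of convergence\<close>

lemma act12_column:
  assumes "\<And>x. A $ x $ (u, u) = (if x = (u, u) then c else 0)"
  shows "act12 A $ x $ (u, u, v) = (if x = (u, u, v) then c else 0)"
  using assms by (cases x) (auto simp: act12_def)

lemma act23_row:
  assumes "\<And>x. A $ (u, u) $ x = (if x = (u, u) then c else 0)"
  shows "act23 A $ (v, u, u) $ x = (if x = (v, u, u) then c else 0)"
  using assms by (cases x) (auto simp: act23_def)

text \<open>The column hypothesis on C and the row hypothesis on A fix both intermediate indices, so
  a single path survives in the double sum.\<close>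

lemma act23_act13_act12_nth:
  assumes "\<And>x. A $ (u, u) $ x = (if x = (u, u) then c else 0)"
    and "\<And>x. C $ x $ (u, u) = (if x = (u, u) then d else 0)"
  shows "(act23 A ** act13 B ** act12 C) $ (v, u, u) $ (u, u, v) = c * B $ (v, u) $ (u, v) * d"
proof -
  have "(act23 A ** act13 B) $ (v, u, u) $ (u, u, v) = c * B $ (v, u) $ (u, v)"
    unfolding matrix_matrix_mult_def
    by (simp add: act23_row[OF assms(1)] if_distrib[of "\<lambda>x. x * _"] act13_def cong: if_cong)
  thus ?thesis
    unfolding matrix_matrix_mult_def[of "_ ** _"]
    by (simp add: act12_column[OF assms(2)] if_distrib[of "\<lambda>x. _ * x"] cong: if_cong)
qed

lemma not_satisfies_YBE:
  fixes R :: "int \<Rightarrow> 'n::finite op2"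
  assumes col: "\<And>k x. R k $ x $ (u, u) = (if x = (u, u) then f k else 0)"
    and row: "\<And>k x. R k $ (u, u) $ x = (if x = (u, u) then f k else 0)"
    and perm: "\<And>k. R k $ (v, u) $ (u, v) = P"
    and lim: "(\<lambda>m. f (int m)) \<longlonglongrightarrow> L" and "L \<noteq> 0" "P \<noteq> 0"
  shows "\<not> satisfies_YBE R"
proof
  let ?T = "triple_terms (in_w (\<lambda>k. act23 (R k))) (in_zw (\<lambda>k. act13 (R k)))
    (in_z (\<lambda>k. act12 (R k))) 0"
  \<comment> \<open>These terms pair w^m from \<open>R23\<close> with (zw)^(-m) from
    \<open>R13\<close>; total exponent 0 leaves z^m for \<open>R12\<close>.\<close>
  define h where "h = (\<lambda>m. ((0 :: int, int m), (- int m, - int m)))"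
  have inj: "inj h" by (auto simp: h_def inj_on_def)
  assume "satisfies_YBE R"
  hence "?T summable_on UNIV"
    unfolding satisfies_YBE_def triple_product_defined_def Let_def by blast
  hence "(\<lambda>x. ?T x $ (v, u, u) $ (u, u, v)) summable_on UNIV"
    by (rule summable_on_bounded_linear[OF bounded_linear_entry])
  \<comment> \<open>Unconditional summability passes to subfamilies, so divergence along
    \<open>h\<close> suffices.\<close>
  hence "(\<lambda>x. ?T x $ (v, u, u) $ (u, u, v)) summable_on range h"
    by (rule summable_on_subset_banach) auto
  hence "(\<lambda>m. ?T (h m) $ (v, u, u) $ (u, u, v)) summable_on UNIV"
    by (subst (asm) summable_on_reindex[OF inj]) (simp add: o_def)
  moreover have "?T (h m) $ (v, u, u) $ (u, u, v) = f (int m) * P * f (int m)" for m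
    using act23_act13_act12_nth[OF row col]
    by (simp add: h_def triple_terms_def in_w_def in_zw_def in_z_def zero_prod_def perm)
  ultimately have "summable (\<lambda>m. f (int m) * P * f (int m))"
    by (auto dest: summable_on_imp_summable)
  hence "(\<lambda>m. f (int m) * P * f (int m)) \<longlonglongrightarrow> 0"
    by (rule summable_LIMSEQ_zero)
  moreover have "(\<lambda>m. f (int m) * P * f (int m)) \<longlonglongrightarrow> L * P * L"
    by (intro tendsto_intros lim)
  ultimately have "L * P * L = 0" using LIMSEQ_unique by blast
  with \<open>L \<noteq> 0\<close> \<open>P \<noteq> 0\<close> show False by simp
qed

theorem proposition4:
  fixes q s :: complex
  assumes "CARD('n::{finite,linorder}) \<ge> 2"
    and "q \<noteq> 0" and "norm q < 1"
    and "s ^ CARD('n) = q"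
  shows "\<not> satisfies_YBE (RD q s :: int \<Rightarrow> 'n op2)"
proof -
  let ?R = "RD q s :: int \<Rightarrow> 'n op2"
  let ?P = "prefactor CARD('n) q s 1"
  note nth = RD_nth[OF assms(2,3), of s]
  note sums = expand_prefactor_sums[of "CARD('n)", OF _ assms(2,3), of s]
  obtain u v :: 'n where uv: "u < v"
  proof -
    have "\<not> is_singleton (UNIV :: 'n set)"
      using assms(1) by (auto simp: is_singleton_altdef)
    then obtain a b :: 'n where "a \<noteq> b"
      by (metis UNIV_I is_singletonI' empty_not_UNIV)
    thus ?thesis using that by (metis linorder_neqE)
  qed
  have "s \<noteq> 0" using assms by (auto simp: power_0_left)
  hence P: "?P \<noteq> 0" using assms by (intro prefactor_1_nonzero) auto
  \<comment> \<open>Weight conservation: the matrix only fixes or swaps the two tensor indices, so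
    row and column (u, u) are supported on the diagonal.\<close>
  have zero: "?R k $ (a, b) $ (a', b') = 0" if "\<not> (a = a' \<and> b = b')" "\<not> (a = b' \<and> b = a')"
    for k a b a' b'
    using that by (subst nth) (auto simp: RD_bracket_nth)
  show ?thesis
  \<comment> \<open>The value p(1) serves twice: as the limit of the partial sums and as the
    constant coefficient of the \<delta> entry.\<close>
  proof (rule not_satisfies_YBE[OF _ _ _ _ P P])
    show "?R k $ x $ (u, u) = (if x = (u, u) then ?R k $ (u, u) $ (u, u) else 0)" for k x
      by (cases x) (auto intro!: zero)
    show "?R k $ (u, u) $ x = (if x = (u, u) then ?R k $ (u, u) $ (u, u) else 0)" for k x
      by (cases x) (auto intro!: zero)
    show "?R k $ (v, u) $ (u, v) = ?P" for k
      using uv infsumI[OF sums(2)] by (subst nth) (simp add: RD_bracket_nth)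
    show "(\<lambda>m. ?R (int m) $ (u, u) $ (u, u)) \<longlonglongrightarrow> ?P"
      using sums(1) by (simp add: RD_diagonal_nth[OF assms(2,3)] sums_def_le)
  qed
qed

end
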